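(* Let $n$ be a positive integer, and consider all $2^{2n}\times(2n+2)$ two-level designs generated by $G=(v,I_n)$ as $v$ ranges over $Z_4^n$. For such $v$ and $i=0,1,2,3$, let $f_i$ be the number of entries of $v$ equal to $i$. Among all these designs: (a) If $n=3k-1$ with $k\ge1$, then a design $D$ defined by a vector $v$ with $f_1+f_3=2k-1$ and $f_2=k$ has maximum resolution $4k$. (b) If $n=3k$ with $k\ge1$, then a design $D$ defined by a vector $v$ with $f_1+f_3=2k$ and $f_2=k$ has maximum resolution $4k+2-2^{-k}$. (c) If $n=3k+1$ with $k\ge1$, then a design $D$ defined by a vector $v$ with $f_1+f_3=2k+1$ and $f_2=k$ has maximum resolution $4k+3-2^{-k}$.
   Context: $Z_4=\{0,1,2,3\}$ is the ring of integers modulo 4. Design generated by $G=(v,I_n)$: let $C$ be the $2^{2n}\times(n+1)$ matrix whose rows are all linear combinations $uG$, $u\in Z_4^n$. Replace each entry of $C$ by a pair of $\pm1$ symbols via the Gray map $0\mapsto(1,1)$, $1\mapsto(1,-1)$, $2\mapsto(-1,-1)$, $3\mapsto(-1,1)$, so that column $j$ of $C$ becomes columns $2j-1,2j$. The result $D$ is a $2^{2n}\times(2n+2)$ matrix with entries $\pm1$ (a two-level design; rows are runs, columns are factors). For a two-level design $D$ with $N$ runs and a nonempty set $s$ of $k$ columns, let $\rho_k(s;D)=\frac1N\left|\sum_{i=1}^N\prod_{c\in s}c_i\right|$, where $c_i$ is the $i$th entry of column $c$. Let $r$ be the smallest integer with $\max_{|s|=r}\rho_r(s;D)>0$. The (generalized)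 resolution of $D$ is $R(D)=r+1-\max_{|s|=r}\rho_r(s;D)$. "$D$ has maximum resolution $x$ among a class of designs" means $R(D)=x$ and $R(D^* )\le x$ for every design $D^*$ in the class. *)

theory Defs
  imports
    Complex_Main
    "HOL-Library.Numeral_Type"
    "Jordan_Normal_Form.Matrix"
begin

text \<open>
  The numeral type \<open>4\<close> is the ring of integers modulo 4.
  A two-level design is a real matrix with entries 1 and -1: rows are runs, columns are factors.
  Rows and columns are numbered from 0.
\<close>

section \<open>Generalized resolution\<close>

definition rho :: "real mat \<Rightarrow> nat set \<Rightarrow> real" where
  "rho D s = \<bar>\<Sum>i<dim_row D. \<Prod>c\<in>s. D $$ (i, c)\<bar> / real (dim_row D)"

definition max_rho :: "real mat \<Rightarrow> nat \<Rightarrow> real" where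
  "max_rho D k = Max {rho D s | s. s \<subseteq> {..<dim_col D} \<and> card s = k}"

text \<open>
  The bounds on \<open>r\<close> restrict to nonempty column sets and keep the maximum in
  \<open>max_rho\<close> over a nonempty set.
\<close>

definition min_word_length :: "real mat \<Rightarrow> nat" where
  "min_word_length D = (LEAST r. 1 \<le> r \<and> r \<le> dim_col D \<and> max_rho D r > 0)"

definition resolution :: "real mat \<Rightarrow> real" where
  "resolution D = real (min_word_length D) + 1 - max_rho D (min_word_length D)"

definition has_max_resolution :: "real mat \<Rightarrow> real \<Rightarrow> real mat set \<Rightarrow> bool" where
  "has_max_resolution D x \<D> \<longleftrightarrow>
     D \<in> \<D> \<and> resolution D = x \<and> (\<forall>D'\<in>\<D>. resolution D' \<le> x)"


section \<open>Designs generated by quaternary linear codes\<close>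

definition gen_mat :: "nat \<Rightarrow> 4 vec \<Rightarrow> 4 mat" where
  "gen_mat n v = mat_of_cols n (v # cols (1\<^sub>m n))"

text \<open>
  The rows of \<open>coeff_mat n\<close> are all vectors \<open>u\<close> of length \<open>n\<close> over the integers modulo 4,
  each exactly once: the entries of row \<open>i\<close> are the base-4 digits of \<open>i\<close>. This fixes an order
  of the runs, on which the resolution does not depend.
\<close>

definition coeff_mat :: "nat \<Rightarrow> 4 mat" where
  "coeff_mat n = mat (2 ^ (2 * n)) n (\<lambda>(i, j). of_nat (i div 4 ^ j))"

definition code_mat :: "nat \<Rightarrow> 4 vec \<Rightarrow> 4 mat" where
  "code_mat n v = coeff_mat n * gen_mat n v"

definition gray :: "4 \<Rightarrow> real \<times> real" where
  "gray z = (if z = 0 then (1, 1)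
             else if z = 1 then (1, -1)
             else if z = 2 then (-1, -1)
             else (-1, 1))"

definition design :: "nat \<Rightarrow> 4 vec \<Rightarrow> real mat" where
  "design n v = mat (2 ^ (2 * n)) (2 * n + 2)
     (\<lambda>(i, c). (if even c then fst else snd) (gray (code_mat n v $$ (i, c div 2))))"

definition generated_designs :: "nat \<Rightarrow> real mat set" where
  "generated_designs n = design n ` carrier_vec n"

definition freq :: "4 vec \<Rightarrow> 4 \<Rightarrow> nat" where
  "freq v a = card {j. j < dim_vec v \<and> v $ j = a}"


section \<open>The runs are indexed by all coefficient vectors\<close>

lemma of_nat_eq_4_iff: "(of_nat a :: 4) = of_nat b \<longleftrightarrow> a mod 4 = b mod 4"
proof -
  have "(of_nat a :: 4) = Abs_bit0 (int a mod 4)" for a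
    using bit0.of_nat_eq[where 'a = "num1 bit0"] by (simp add: Abs_bit0'_def)
  moreover have "int x mod 4 \<in> {0..<2 * int CARD(num1 bit0)}" for x
    by simp
  ultimately have "(of_nat a :: 4) = of_nat b \<longleftrightarrow> int a mod 4 = int b mod 4"
    by (simp add: Abs_bit0_inject)
  also have "\<dots> \<longleftrightarrow> a mod 4 = b mod 4"
    using of_nat_eq_iff[where 'a = int, of "a mod 4" "b mod 4"]
    by (simp only: of_nat_mod of_nat_numeral)
  finally show ?thesis .
qed

lemma eq_if_digits_eq:
  fixes a b :: nat
  assumes "a < 4 ^ n" "b < 4 ^ n" "\<And>j. j < n \<Longrightarrow> a div 4 ^ j mod 4 = b div 4 ^ j mod 4"
  shows "a = b"
  using assms
proof (induction n arbitrary: a b)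
  case 0
  then show ?case by simp
next
  case (Suc n)
  have "a div 4 = b div 4"
  proof (rule Suc.IH)
    show "a div 4 < 4 ^ n" "b div 4 < 4 ^ n"
      using Suc.prems(1,2) by (simp_all add: div_less_iff_less_mult mult.commute)
    show "a div 4 div 4 ^ j mod 4 = b div 4 div 4 ^ j mod 4" if "j < n" for j
      using Suc.prems(3)[of "Suc j"] that by (simp add: div_mult2_eq)
  qed
  moreover have "a mod 4 = b mod 4" using Suc.prems(3)[of 0] by simp
  ultimately have "4 * (a div 4) + a mod 4 = 4 * (b div 4) + b mod 4" by (simp only:)
  then show ?case by (simp only: mult_div_mod_eq)
qed

lemma card_carrier_vec_4: "card (carrier_vec n :: 4 vec set) = 4 ^ n"
  and finite_carrier_vec_4: "finite (carrier_vec n :: 4 vec set)"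
proof -
  have "bij_betw (\<lambda>f. vec n f) ({..<n} \<rightarrow>\<^sub>E (UNIV :: 4 set)) (carrier_vec n)"
  proof (rule bij_betwI[where g = "\<lambda>v. restrict (\<lambda>j. v $ j) {..<n}"])
    show "restrict (\<lambda>j. vec n f $ j) {..<n} = f" if "f \<in> {..<n} \<rightarrow>\<^sub>E UNIV" for f :: "nat \<Rightarrow> 4"
      using that by (auto simp: restrict_def PiE_def extensional_def fun_eq_iff)
  qed auto
  moreover have "card ({..<n} \<rightarrow>\<^sub>E (UNIV :: 4 set)) = 4 ^ n" by (simp add: card_PiE)
  moreover have "finite ({..<n} \<rightarrow>\<^sub>E (UNIV :: 4 set))" by (simp add: finite_PiE)
  ultimately show "card (carrier_vec n :: 4 vec set) = 4 ^ n"
    and "finite (carrier_vec n :: 4 vec set)"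
    using bij_betw_same_card bij_betw_finite by metis+
qed

lemma bij_betw_row_coeff_mat:
  "bij_betw (row (coeff_mat n)) {..<2 ^ (2 * n)} (carrier_vec n)"
proof -
  have pow: "(2::nat) ^ (2 * n) = 4 ^ n" by (simp add: power_mult)
  have inj: "inj_on (row (coeff_mat n)) {..<2 ^ (2 * n)}"
  proof (rule inj_onI)
    fix a b
    assume ab: "a \<in> {..<(2::nat) ^ (2 * n)}" "b \<in> {..<(2::nat) ^ (2 * n)}"
      and eq: "row (coeff_mat n) a = row (coeff_mat n) b"
    have "a div 4 ^ j mod 4 = b div 4 ^ j mod 4" if "j < n" for j
    proof -
      have "row (coeff_mat n) a $ j = row (coeff_mat n) b $ j" using eq by simp
      then show ?thesis using ab that by (simp add: coeff_mat_def of_nat_eq_4_iff)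
    qed
    moreover have "a < 4 ^ n" "b < 4 ^ n" using ab by (simp_all only: lessThan_iff pow)
    ultimately show "a = b" by (rule eq_if_digits_eq[rotated 2])
  qed
  moreover have "row (coeff_mat n) ` {..<2 ^ (2 * n)} = carrier_vec n"
  proof (rule card_subset_eq)
    show "finite (carrier_vec n :: 4 vec set)" by (rule finite_carrier_vec_4)
    show "row (coeff_mat n) ` {..<2 ^ (2 * n)} \<subseteq> carrier_vec n"
      by (rule image_subsetI, rule carrier_vecI) (simp add: coeff_mat_def)
    show "card (row (coeff_mat n) ` {..<2 ^ (2 * n)}) = card (carrier_vec n :: 4 vec set)"
      unfolding card_image[OF inj] by (simp only: card_lessThan card_carrier_vec_4 pow)
  qed
  ultimately show ?thesis by (simp add: bij_betw_def)
qed

end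

theory Submission
  imports Defs
begin

text \<open>
  Write \<open>\<chi> z = \<i>\<^sup>z\<close>. The two Gray columns of a coordinate are \<open>Re ((1 \<mp> \<i>) \<chi> z)\<close> and their product is
  \<open>\<chi> (2 z)\<close>. Expanding the factor of the coordinate \<open>u \<bullet> v\<close> in this way turns the sum over all runs
  into the real part of a product over \<open>j\<close> of Fourier coefficients at multiples of \<open>v\<^sub>j\<close>. Put
  \<open>m = f\<^sub>1 + f\<^sub>3\<close> and \<open>f = f\<^sub>2\<close>. Column sets containing both columns of \<open>u \<bullet> v\<close> contribute only in size
  \<open>2 + 2 m\<close>, with correlation 1. Those containing exactly one of them contribute only in size
  \<open>1 + m + 2 f\<close>, where the product is \<open>2\<^bsup>-m\<^esup>\<close> times \<open>m + 1\<close> factors \<open>1 \<plusminus> \<i>\<close> and its real part is at most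
  \<open>2\<^bsup>-(m div 2)\<^esup>\<close>, with equality for some choice of columns. Hence the resolution is
  \<open>2 + m + 2 f - 2\<^bsup>-(m div 2)\<^esup>\<close> if \<open>2 f \<le> m\<close> and \<open>2 + 2 m\<close> otherwise, and it remains to maximize
  this subject to \<open>m + f \<le> n\<close>.
\<close>

section \<open>Characters of the integers modulo 4 and the Gray map\<close>

lemma UNIV_4: "(UNIV :: 4 set) = {0, 1, 2, 3}"
proof -
  have "card {0, 1, 2, 3 :: 4} = 4" by simp
  then show ?thesis by (intro card_subset_eq[symmetric]) simp_all
qed

lemma exhaust_4: obtains "z = (0::4)" | "z = 1" | "z = 2" | "z = 3"
  using UNIV_4 by blast

lemma forall_4: "(\<forall>z::4. P z) \<longleftrightarrow> P 0 \<and> P 1 \<and> P 2 \<and> P 3"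
  by (metis exhaust_4)

definition char4 :: "4 \<Rightarrow> complex" where
  "char4 z = (if z = 0 then 1 else if z = 1 then \<i> else if z = 2 then - 1 else - \<i>)"

lemma char4_simps [simp]: "char4 0 = 1" "char4 1 = \<i>" "char4 2 = - 1" "char4 3 = - \<i>"
  by (simp_all add: char4_def)

text \<open>Numeral arithmetic in type \<open>4\<close> does not reduce modulo 4; these are the
  unreduced sums and products of two residues met below.\<close>

lemma char4_numerals [simp]: "char4 4 = 1" "char4 5 = \<i>" "char4 6 = - 1" "char4 9 = \<i>"
  by (simp_all add: char4_def)

lemma char4_add: "char4 (x + y) = char4 x * char4 y"
proof -
  have "\<forall>x y. char4 (x + y) = char4 x * char4 y"
    unfolding forall_4 by (simp)
  then show ?thesis by blast
qed

lemma char4_sum: "finite A \<Longrightarrow> char4 (\<Sum>j\<in>A. f j) = (\<Prod>j\<in>A. char4 (f j))"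
  by (induction A rule: finite_induct) (simp_all add: char4_add)

text \<open>What one coordinate contributes to a product over a column set: \<open>p\<close> and
  \<open>q\<close> record whether its first and its second column are selected.\<close>

definition gray_factor :: "bool \<Rightarrow> bool \<Rightarrow> 4 \<Rightarrow> real" where
  "gray_factor p q z = (if p then fst (gray z) else 1) * (if q then snd (gray z) else 1)"

definition char_index :: "bool \<Rightarrow> bool \<Rightarrow> 4" where
  "char_index p q = (if p \<noteq> q then 1 else if p then 2 else 0)"

definition char_coef :: "bool \<Rightarrow> bool \<Rightarrow> complex" where
  "char_coef p q = (if p = q then 1 else if p then 1 - \<i> else 1 + \<i>)"

text \<open>The Fourier coefficient of \<open>gray_factor p q\<close> at frequency \<open>w\<close>,
  normalized as a mean over the four residues.\<close>

definition fourier :: "bool \<Rightarrow> bool \<Rightarrow> 4 \<Rightarrow> complex" where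
  "fourier p q w = (\<Sum>z\<in>UNIV. of_real (gray_factor p q z) * char4 (w * z)) / 4"

lemma gray_factor_eq_Re: "gray_factor p q z = Re (char_coef p q * char4 (char_index p q * z))"
proof -
  have "\<forall>z. gray_factor p q z = Re (char_coef p q * char4 (char_index p q * z))"
    unfolding forall_4 by (auto simp: gray_factor_def gray_def char_coef_def char_index_def)
  then show ?thesis by blast
qed

text \<open>The supports drive the classification of column sets: frequency 0 detects only the empty
  selection, frequency 2 only both columns, an odd frequency only a single column. In the last case
  the value is \<open>1 + \<i>\<close> or \<open>1 - \<i>\<close>, halved.\<close>

lemma fourier_0: "fourier p q 0 = (if p \<or> q then 0 else 1)"
  and fourier_2: "fourier p q 2 = (if p \<and> q then 1 else 0)"
  and fourier_1: "fourier p q 1 = (if p = q then 0 else if p then (1 + \<i>) / 2 else (1 - \<i>) / 2)"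
  and fourier_3: "fourier p q 3 = (if p = q then 0 else if p then (1 - \<i>) / 2 else (1 + \<i>) / 2)"
  unfolding fourier_def UNIV_4
  by (auto simp: gray_factor_def gray_def complex_eq_iff)

lemma fourier_numerals: "fourier p q 4 = fourier p q 0" "fourier p q 6 = fourier p q 2"
proof -
  have "4 = (0::4)" "6 = (2::4)" by simp_all
  then show "fourier p q 4 = fourier p q 0" "fourier p q 6 = fourier p q 2" by (simp_all only:)
qed

section \<open>Correlations as products of Fourier coefficients\<close>

lemma prod_in_pairs: fixes f :: "nat \<Rightarrow> 'a::comm_monoid_mult"
  shows "(\<Prod>c<2 * n + 2. f c) = (\<Prod>j\<le>n. f (2 * j) * f (Suc (2 * j)))"
  using prod.in_pairs_0[of f n] by (simp add: lessThan_Suc_atMost)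

lemma card_eq_sum_pairs:
  assumes "s \<subseteq> {..<2 * n + 2}"
  shows "card s = (\<Sum>j\<le>n. of_bool (2 * j \<in> s) + of_bool (Suc (2 * j) \<in> s))"
proof -
  have "card s = (\<Sum>c<2 * n + 2. of_bool (c \<in> s))"
    using assms by (subst sum_of_bool_eq) (auto intro: arg_cong[where f = card])
  also have "\<dots> = (\<Sum>j\<le>n. of_bool (2 * j \<in> s) + of_bool (Suc (2 * j) \<in> s))"
    using sum.in_pairs_0[of "\<lambda>c. of_bool (c \<in> s)" n]
    by (simp only: lessThan_Suc_atMost add_2_eq_Suc')
  finally show ?thesis .
qed

lemma code_mat_0: "i < 2 ^ (2 * n) \<Longrightarrow> v \<in> carrier_vec n \<Longrightarrow>
    code_mat n v $$ (i, 0) = row (coeff_mat n) i \<bullet> v"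
  by (simp add: code_mat_def gen_mat_def coeff_mat_def)

lemma code_mat_Suc: "i < 2 ^ (2 * n) \<Longrightarrow> v \<in> carrier_vec n \<Longrightarrow> j < n \<Longrightarrow>
    code_mat n v $$ (i, Suc j) = row (coeff_mat n) i $ j"
  by (simp add: code_mat_def gen_mat_def coeff_mat_def)

lemma prod_design:
  assumes "i < 2 ^ (2 * n)" "v \<in> carrier_vec n" "s \<subseteq> {..<2 * n + 2}"
  shows "(\<Prod>c\<in>s. design n v $$ (i, c)) =
    (\<Prod>j\<le>n. gray_factor (2 * j \<in> s) (Suc (2 * j) \<in> s) (code_mat n v $$ (i, j)))"
proof -
  have "(\<Prod>c\<in>s. design n v $$ (i, c)) = (\<Prod>c<2 * n + 2. if c \<in> s then design n v $$ (i, c) else 1)"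
    using assms(3) by (subst prod.inter_restrict[symmetric]) (auto intro!: prod.cong)
  also have "\<dots> = (\<Prod>j\<le>n. gray_factor (2 * j \<in> s) (Suc (2 * j) \<in> s) (code_mat n v $$ (i, j)))"
    unfolding prod_in_pairs using assms(1)
    by (intro prod.cong) (auto simp: design_def gray_factor_def)
  finally show ?thesis .
qed

lemma bij_betw_vec: "bij_betw (vec n) ({..<n} \<rightarrow>\<^sub>E (UNIV :: 'a set)) (carrier_vec n)"
  by (rule bij_betwI[where g = "\<lambda>v. restrict (vec_index v) {..<n}"])
    (auto simp: restrict_def PiE_def extensional_def fun_eq_iff)

lemma Re_of_real_mult: "Re (of_real r * z) = r * Re z"
  and Re_mult_of_real: "Re (z * of_real r) = Re z * r"
  by simp_all

text \<open>Once the factor of the coordinate \<open>u \<bullet> v\<close> is written as the real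
  part of a character value, the summand splits over the entries of \<open>u\<close>. These run
  independently through all residues, so the sum over the runs factorizes. Coordinate 0 is
  \<open>u \<bullet> v\<close>, and coordinate \<open>Suc j\<close> is the entry
  \<open>u $ j\<close>.\<close>

lemma rho_design:
  assumes v: "v \<in> carrier_vec n" and s: "s \<subseteq> {..<2 * n + 2}"
  defines "t \<equiv> char_index (0 \<in> s) (1 \<in> s)"
  shows "rho (design n v) s = \<bar>Re (char_coef (0 \<in> s) (1 \<in> s) *
    (\<Prod>j<n. fourier (2 * Suc j \<in> s) (Suc (2 * Suc j) \<in> s) (t * v $ j)))\<bar>"
proof -
  let ?g = "\<lambda>j. gray_factor (2 * j \<in> s) (Suc (2 * j) \<in> s)"
  let ?c = "char_coef (0 \<in> s) (1 \<in> s)"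
  have row: "(\<Prod>c\<in>s. design n v $$ (i, c)) =
      Re (?c * (\<Prod>j<n. of_real (?g (Suc j) (u $ j)) * char4 (t * v $ j * u $ j)))"
    if i: "i < 2 ^ (2 * n)" and u: "u = row (coeff_mat n) i" for i u
  proof -
    have "(\<Prod>c\<in>s. design n v $$ (i, c)) = ?g 0 (u \<bullet> v) * (\<Prod>j<n. ?g (Suc j) (u $ j))"
      unfolding prod_design[OF i v s] prod.atMost_shift code_mat_0[OF i v] u
      by (simp add: code_mat_Suc[OF i v])
    also have "?g 0 (u \<bullet> v) = Re (?c * char4 (t * (u \<bullet> v)))"
      by (simp add: gray_factor_eq_Re t_def)
    also have "t * (u \<bullet> v) = (\<Sum>j<n. t * v $ j * u $ j)"
      using v by (simp add: scalar_prod_def sum_distrib_left atLeast0LessThan ac_simps)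
    \<comment> \<open>The remaining Gray factors are real, so they may be moved inside
      \<open>Re\<close>.\<close>
    also have "Re (?c * char4 \<dots>) * (\<Prod>j<n. ?g (Suc j) (u $ j)) =
        Re (?c * char4 (\<Sum>j<n. t * v $ j * u $ j) * of_real (\<Prod>j<n. ?g (Suc j) (u $ j)))"
      by (simp only: Re_mult_of_real)
    finally show ?thesis
      by (simp del: times_complex.simps add: char4_sum prod.distrib ac_simps)
  qed
  have "(\<Sum>i<2 ^ (2 * n). \<Prod>c\<in>s. design n v $$ (i, c)) =
      Re (?c * (\<Sum>i<2 ^ (2 * n). (\<lambda>u. \<Prod>j<n. of_real (?g (Suc j) (u $ j)) * char4 (t * v $ j * u $ j))
        (row (coeff_mat n) i)))"
    by (simp add: row sum_distrib_left del: times_complex.simps)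
  also have "\<dots> = Re (?c * (\<Sum>u\<in>carrier_vec n. \<Prod>j<n. of_real (?g (Suc j) (u $ j)) * char4 (t * v $ j * u $ j)))"
    by (subst sum.reindex_bij_betw[OF bij_betw_row_coeff_mat]) simp
  also have "(\<Sum>u\<in>carrier_vec n. \<Prod>j<n. of_real (?g (Suc j) (u $ j)) * char4 (t * v $ j * u $ j)) =
     (\<Sum>f\<in>{..<n} \<rightarrow>\<^sub>E UNIV. \<Prod>j<n. of_real (?g (Suc j) (f j)) * char4 (t * v $ j * f j))"
    by (subst sum.reindex_bij_betw[OF bij_betw_vec, symmetric]) simp
  \<comment> \<open>Distributivity: a sum over all functions of a product is a product of
    sums.\<close>
  also have "\<dots> = (\<Prod>j<n. \<Sum>z\<in>UNIV. of_real (?g (Suc j) z) * char4 (t * v $ j * z))"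
    by (rule prod_sum_PiE[symmetric]) simp_all
  also have "\<dots> = (\<Prod>j<n. 4 * fourier (2 * Suc j \<in> s) (Suc (2 * Suc j) \<in> s) (t * v $ j))"
    by (simp add: fourier_def)
  also have "\<dots> = of_real (2 ^ (2 * n)) * 
      (\<Prod>j<n. fourier (2 * Suc j \<in> s) (Suc (2 * Suc j) \<in> s) (t * v $ j))"
    by (simp add: prod.distrib power_mult)
  also have "Re (?c * \<dots>) = 2 ^ (2 * n) *
      Re (?c * (\<Prod>j<n. fourier (2 * Suc j \<in> s) (Suc (2 * Suc j) \<in> s) (t * v $ j)))"
    by (simp only: mult.left_commute[of ?c] Re_of_real_mult)
  finally show ?thesis
    by (simp add: rho_def abs_mult design_def del: times_complex.simps)
qed

section \<open>Products of factors \<open>1 + \<i>\<close> and \<open>1 - \<i>\<close>\<close>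

text \<open>Multiplying \<open>x + \<i> y\<close> by such a factor gives coordinates of absolute
  values \<open>\<bar>x - y\<bar>\<close> and \<open>\<bar>x + y\<bar>\<close>. Their sum is twice
  the old maximum and their maximum is the old sum, so the two norms must be carried through the
  induction together.\<close>

lemma norm_prod_gaussian:
  fixes c :: "'a \<Rightarrow> complex"
  assumes "finite A" "\<And>j. j \<in> A \<Longrightarrow> c j = 1 + \<i> \<or> c j = 1 - \<i>"
  defines "Z \<equiv> \<lambda>A. \<Prod>j\<in>A. c j"
  shows "\<bar>Re (Z A)\<bar> + \<bar>Im (Z A)\<bar> = 2 ^ (Suc (card A) div 2) \<and>
    max (\<bar>Re (Z A)\<bar>) (\<bar>Im (Z A)\<bar>) = 2 ^ (card A div 2)"
  using assms(1,2)
proof (induction A rule: finite_induct)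
  case empty
  then show ?case by (simp add: Z_def)
next
  case (insert j A)
  define x y where "x = Re (Z A)" and "y = Im (Z A)"
  have c: "Re (c j) = 1" "Im (c j) = 1 \<or> Im (c j) = - 1"
    using insert.prems[of j] by auto
  have "\<bar>Re (Z (insert j A))\<bar> + \<bar>Im (Z (insert j A))\<bar> = \<bar>x - y\<bar> + \<bar>x + y\<bar>"
    and "max (\<bar>Re (Z (insert j A))\<bar>) (\<bar>Im (Z (insert j A))\<bar>) = max (\<bar>x - y\<bar>) (\<bar>x + y\<bar>)"
    using c insert.hyps unfolding x_def y_def
    by (auto simp: Z_def algebra_simps max.commute abs_minus_commute)
  moreover have "\<bar>x - y\<bar> + \<bar>x + y\<bar> = 2 * max (\<bar>x\<bar>) (\<bar>y\<bar>)" "max (\<bar>x - y\<bar>) (\<bar>x + y\<bar>) = \<bar>x\<bar> + \<bar>y\<bar>"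
    by linarith+
  ultimately show ?case
    using insert by (simp add: x_def y_def)
qed

lemma two_power_split: "(2::real) ^ (Suc m div 2) / 2 ^ m = 1 / 2 ^ (m div 2)"
proof -
  have "(2::real) ^ m = 2 ^ (Suc m div 2 + m div 2)"
    by (rule arg_cong[where f = "power 2"]) presburger
  then show ?thesis by (simp add: power_add)
qed

section \<open>Counting the entries of \<open>v\<close>\<close>

definition odd_positions :: "nat \<Rightarrow> 4 vec \<Rightarrow> nat set" where
  "odd_positions n v = {j. j < n \<and> (v $ j = 1 \<or> v $ j = 3)}"

lemma finite_odd_positions [simp]: "finite (odd_positions n v)"
  by (simp add: odd_positions_def)

lemma card_odd_positions:
  assumes "v \<in> carrier_vec n"
  shows "card (odd_positions n v) = freq v 1 + freq v 3"
proof -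
  have "odd_positions n v = {j. j < n \<and> v $ j = 1} \<union> {j. j < n \<and> v $ j = 3}"
    by (auto simp: odd_positions_def)
  also have "card \<dots> = card {j. j < n \<and> v $ j = 1} + card {j. j < n \<and> v $ j = 3}"
    by (rule card_Un_disjoint) auto
  finally show ?thesis using assms by (simp add: freq_def)
qed

lemma freq_add_le:
  assumes "v \<in> carrier_vec n"
  shows "freq v 1 + freq v 3 + freq v 2 \<le> n"
proof -
  have "freq v 1 + freq v 3 + freq v 2 = card (odd_positions n v \<union> {j. j < n \<and> v $ j = 2})"
    using assms unfolding card_odd_positions[OF assms, symmetric]
    by (subst card_Un_disjoint) (auto simp: odd_positions_def freq_def)
  also have "\<dots> \<le> card {..<n}"
    by (rule card_mono) (auto simp: odd_positions_def)
  finally show ?thesis by simp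
qed

lemma card_eq_sum_shift:
  assumes "s \<subseteq> {..<2 * n + 2}"
  shows "card s = of_bool (0 \<in> s) + of_bool (1 \<in> s) +
    (\<Sum>j<n. of_bool (2 * Suc j \<in> s) + of_bool (Suc (2 * Suc j) \<in> s))"
  unfolding card_eq_sum_pairs[OF assms] sum.atMost_shift by simp

section \<open>Column sets with nonzero correlation\<close>

context
  fixes n :: nat and v :: "4 vec" and s :: "nat set"
  assumes v: "v \<in> carrier_vec n" and s: "s \<subseteq> {..<2 * n + 2}"
begin

text \<open>Together with the supports of the Fourier coefficients, this fixes how many columns are
  selected at each coordinate.\<close>

lemma factor_nonzero:
  assumes "rho (design n v) s > 0" "j < n"
  shows "fourier (2 * Suc j \<in> s) (Suc (2 * Suc j) \<in> s) (char_index (0 \<in> s) (1 \<in> s) * v $ j) \<noteq> 0"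
proof
  assume "fourier (2 * Suc j \<in> s) (Suc (2 * Suc j) \<in> s) (char_index (0 \<in> s) (1 \<in> s) * v $ j) = 0"
  then have "(\<Prod>j<n. fourier (2 * Suc j \<in> s) (Suc (2 * Suc j) \<in> s) (char_index (0 \<in> s) (1 \<in> s) * v $ j)) = 0"
    using assms(2) by (intro prod_zero) auto
  then have "rho (design n v) s = 0"
    unfolding rho_design[OF v s] by (simp only: mult_zero_right) simp
  with assms(1) show False by simp
qed

text \<open>All frequencies are 0, so no coordinate admits a selected column.\<close>

lemma word_none:
  assumes "rho (design n v) s > 0" "0 \<notin> s" "1 \<notin> s"
  shows "s = {}"
proof -
  have "2 * Suc j \<notin> s \<and> Suc (2 * Suc j) \<notin> s" if "j < n" for j
    using factor_nonzero[OF assms(1) that] assms(2,3)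
    by (simp add: char_index_def fourier_0 split: if_splits)
  then have "card s = 0"
    using assms(2,3) by (simp add: card_eq_sum_shift[OF s])
  then show ?thesis using finite_subset[OF s] by simp
qed

text \<open>The frequencies are \<open>2 * v $ j\<close>, which is 2 at odd entries and 0 elsewhere:
  both columns are forced at the odd entries, none at the others, and every factor is 1.\<close>

lemma word_both:
  assumes "rho (design n v) s > 0" "0 \<in> s" "1 \<in> s"
  shows "card s = 2 + 2 * (freq v 1 + freq v 3)" "rho (design n v) s = 1"
proof -
  have *: "(of_bool (2 * Suc j \<in> s) + of_bool (Suc (2 * Suc j) \<in> s) :: nat) =
        (if j \<in> odd_positions n v then 2 else 0) \<and>
      fourier (2 * Suc j \<in> s) (Suc (2 * Suc j) \<in> s) (2 * v $ j) = 1" if "j < n" for j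
    using factor_nonzero[OF assms(1) that] assms(2,3) that
    by (cases "v $ j" rule: exhaust_4)
      (simp_all add: char_index_def odd_positions_def fourier_0 fourier_2 fourier_numerals split: if_splits)
  have "card s = 2 + (\<Sum>j<n. if j \<in> odd_positions n v then 2 else 0)"
    using assms(2,3) * by (simp add: card_eq_sum_shift[OF s])
  also have "\<dots> = 2 + 2 * card (odd_positions n v)"
    by (subst sum.If_cases) (auto simp: odd_positions_def intro: arg_cong[where f = card])
  finally show "card s = 2 + 2 * (freq v 1 + freq v 3)"
    by (simp add: card_odd_positions[OF v])
  show "rho (design n v) s = 1"
    using assms(2,3) * by (simp add: rho_design[OF v s] char_index_def char_coef_def)
qed

text \<open>The frequencies are the entries of \<open>v\<close>: an odd entry forces one column, an
  entry 2 both, an entry 0 none. The leading 1 counts the column of coordinate 0.\<close>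

lemma card_word_one:
  assumes "rho (design n v) s > 0" "0 \<in> s \<longleftrightarrow> 1 \<notin> s"
  shows "card s = 1 + (freq v 1 + freq v 3) + 2 * freq v 2"
proof -
  have *: "(of_bool (2 * Suc j \<in> s) + of_bool (Suc (2 * Suc j) \<in> s) :: nat) =
        (if j \<in> odd_positions n v then 1 else 0) + (if v $ j = 2 then 2 else 0)" if "j < n" for j
    using factor_nonzero[OF assms(1) that] assms(2) that
    by (cases "v $ j" rule: exhaust_4)
      (simp_all add: char_index_def odd_positions_def fourier_0 fourier_1 fourier_2 fourier_3 split: if_splits)
  have "card s = 1 + ((\<Sum>j<n. if j \<in> odd_positions n v then 1 else 0) + (\<Sum>j<n. if v $ j = 2 then 2 else 0))"
    unfolding sum.distrib[symmetric] using assms(2) * by (simp add: card_eq_sum_shift[OF s])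
  also have "(\<Sum>j<n. if j \<in> odd_positions n v then 1 else 0) = card (odd_positions n v)"
    by (subst sum.If_cases) (auto simp: odd_positions_def intro: arg_cong[where f = card])
  also have "(\<Sum>j<n. if v $ j = 2 then 2 else 0) = 2 * freq v 2"
    using v by (subst sum.If_cases) (auto simp: freq_def intro: arg_cong[where f = card])
  finally show ?thesis
    by (simp add: card_odd_positions[OF v])
qed

text \<open>The hypothesis asks for nonzero factors instead of a positive correlation, so that it
  also applies to a constructed column set whose correlation is still to be computed. Doubling the
  factors at the odd entries makes them \<open>1 + \<i>\<close> or \<open>1 - \<i>\<close>, at the
  cost of the denominator \<open>2 ^ m\<close>.\<close>

lemma rho_word_one:
  assumes "\<And>j. j < n \<Longrightarrow> fourier (2 * Suc j \<in> s) (Suc (2 * Suc j) \<in> s) (v $ j) \<noteq> 0"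
    and "0 \<in> s \<longleftrightarrow> 1 \<notin> s"
  defines "m \<equiv> freq v 1 + freq v 3"
    and "Z \<equiv> \<Prod>j\<in>odd_positions n v. 2 * fourier (2 * Suc j \<in> s) (Suc (2 * Suc j) \<in> s) (v $ j)"
  shows "rho (design n v) s = \<bar>Re (char_coef (0 \<in> s) (1 \<in> s) * Z)\<bar> / 2 ^ m"
    "\<bar>Re Z\<bar> + \<bar>Im Z\<bar> = 2 ^ (Suc m div 2)"
proof -
  let ?F = "\<lambda>j. fourier (2 * Suc j \<in> s) (Suc (2 * Suc j) \<in> s) (v $ j)"
  have "?F j = 1" if "j < n" "j \<notin> odd_positions n v" for j
    using assms(1)[OF that(1)] that
    by (cases "v $ j" rule: exhaust_4)
      (simp_all add: odd_positions_def fourier_0 fourier_2 split: if_splits)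
  then have "(\<Prod>j<n. ?F j) = (\<Prod>j\<in>odd_positions n v. ?F j)"
    by (intro prod.mono_neutral_right) (auto simp: odd_positions_def)
  also have "\<dots> = Z / of_real (2 ^ m)"
    unfolding Z_def m_def card_odd_positions[OF v, symmetric] by (simp add: prod.distrib)
  finally have "rho (design n v) s = \<bar>Re (char_coef (0 \<in> s) (1 \<in> s) * Z / of_real (2 ^ m))\<bar>"
    using assms(2) by (simp add: rho_design[OF v s] char_index_def del: times_complex.simps)
  then show "rho (design n v) s = \<bar>Re (char_coef (0 \<in> s) (1 \<in> s) * Z)\<bar> / 2 ^ m"
    by (simp only: Re_divide_of_real abs_divide) simp
  have "2 * ?F j = 1 + \<i> \<or> 2 * ?F j = 1 - \<i>" if "j \<in> odd_positions n v" for j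
    using assms(1)[of j] that
    by (auto simp: odd_positions_def fourier_1 fourier_3 split: if_splits)
  then show "\<bar>Re Z\<bar> + \<bar>Im Z\<bar> = 2 ^ (Suc m div 2)"
    using norm_prod_gaussian[of "odd_positions n v" "\<lambda>j. 2 * ?F j"]
    by (simp add: Z_def m_def card_odd_positions[OF v] del: times_complex.simps)
qed

lemma rho_word_one_le:
  assumes "rho (design n v) s > 0" "0 \<in> s \<longleftrightarrow> 1 \<notin> s"
  shows "rho (design n v) s \<le> 1 / 2 ^ ((freq v 1 + freq v 3) div 2)"
proof -
  have F: "fourier (2 * Suc j \<in> s) (Suc (2 * Suc j) \<in> s) (v $ j) \<noteq> 0" if "j < n" for j
    using factor_nonzero[OF assms(1) that] assms(2) by (simp add: char_index_def)
  \<comment> \<open>The coefficient is \<open>1 - \<i>\<close> or \<open>1 + \<i>\<close>, so the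
    real part is \<open>Re Z + Im Z\<close> or \<open>Re Z - Im Z\<close>.\<close>
  have "\<bar>Re (char_coef (0 \<in> s) (1 \<in> s) * Z)\<bar> \<le> \<bar>Re Z\<bar> + \<bar>Im Z\<bar>" for Z
    using assms(2) by (auto simp: char_coef_def)
  then show ?thesis
    unfolding two_power_split[symmetric]
    by (simp only: rho_word_one[OF F assms(2)] divide_right_mono zero_le_power zero_le_numeral
      flip: rho_word_one(2)[OF F assms(2)])
qed

end

section \<open>Column sets attaining the correlations\<close>

lemma ex_word_both:
  assumes v: "v \<in> carrier_vec n"
  shows "\<exists>s\<subseteq>{..<2 * n + 2}. card s = 2 + 2 * (freq v 1 + freq v 3) \<and> rho (design n v) s = 1"
proof -
  \<comment> \<open>Column \<open>c\<close> belongs to coordinate \<open>c div 2\<close>; since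
    coordinate 0 is \<open>u \<bullet> v\<close>, entry \<open>j\<close> of \<open>v\<close> goes
    with coordinate \<open>Suc j\<close>.\<close>
  define s where "s = {c. c < 2 * n + 2 \<and> (c div 2 = 0 \<or> c div 2 - 1 \<in> odd_positions n v)}"
  have s: "s \<subseteq> {..<2 * n + 2}" "0 \<in> s" "1 \<in> s" by (auto simp: s_def)
  have "fourier (2 * Suc j \<in> s) (Suc (2 * Suc j) \<in> s) (2 * v $ j) = 1" if "j < n" for j
    using that by (cases "v $ j" rule: exhaust_4)
      (simp_all add: s_def odd_positions_def fourier_0 fourier_2 fourier_numerals)
  then have "rho (design n v) s = 1"
    using s by (simp add: rho_design[OF v] char_index_def char_coef_def)
  with word_both(1)[OF v s(1)] s show ?thesis by auto
qed

lemma ex_word_one: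
  assumes v: "v \<in> carrier_vec n"
  defines "m \<equiv> freq v 1 + freq v 3"
  shows "\<exists>s\<subseteq>{..<2 * n + 2}. card s = 1 + m + 2 * freq v 2 \<and> rho (design n v) s = 1 / 2 ^ (m div 2)"
proof -
  \<comment> \<open>At an entry 1 the first column is taken and at an entry 3 the second, so that
    every odd entry yields the same factor \<open>(1 + \<i>) / 2\<close>. The flag \<open>b\<close>
    selects the column of coordinate 0 and does not affect \<open>Z\<close>.\<close>
  define s where "s b = {c. c < 2 * n + 2 \<and> (if c div 2 = 0 then even c = b
    else v $ (c div 2 - 1) = 2 \<or> v $ (c div 2 - 1) = (if even c then 1 else 3))}" for b
  define Z where "Z = (\<Prod>j\<in>odd_positions n v. 1 + \<i>)"
  have s: "s b \<subseteq> {..<2 * n + 2}" "0 \<in> s b \<longleftrightarrow> b" "1 \<in> s b \<longleftrightarrow> \<not> b" for b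
    by (auto simp: s_def)
  have F: "fourier (2 * Suc j \<in> s b) (Suc (2 * Suc j) \<in> s b) (v $ j) =
      (if j \<in> odd_positions n v then (1 + \<i>) / 2 else 1)" if "j < n" for j b
    using that by (cases "v $ j" rule: exhaust_4)
      (simp_all add: s_def odd_positions_def fourier_0 fourier_1 fourier_2 fourier_3)
  have F0: "fourier (2 * Suc j \<in> s b) (Suc (2 * Suc j) \<in> s b) (v $ j) \<noteq> 0" if "j < n" for j b
    using F[OF that] by (simp add: complex_eq_iff)
  have Z: "(\<Prod>j\<in>odd_positions n v. 2 * fourier (2 * Suc j \<in> s b) (Suc (2 * Suc j) \<in> s b) (v $ j)) = Z"
    for b
    unfolding Z_def
  proof (rule prod.cong)
    fix j assume "j \<in> odd_positions n v"
    then show "2 * fourier (2 * Suc j \<in> s b) (Suc (2 * Suc j) \<in> s b) (v $ j) = 1 + \<i>"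
      using F[of j b] by (simp add: odd_positions_def mult.commute[of 2 "fourier _ _ _"])
  qed simp
  have rho: "rho (design n v) (s b) = \<bar>Re (char_coef b (\<not> b) * Z)\<bar> / 2 ^ m" for b
    using rho_word_one(1)[OF v s(1) F0, of b] s(2,3)[of b] unfolding Z m_def by simp
  have L1: "\<bar>Re Z\<bar> + \<bar>Im Z\<bar> = 2 ^ (Suc m div 2)"
    using rho_word_one(2)[OF v s(1) F0, of True] s(2,3)[of True] unfolding Z m_def by simp
  \<comment> \<open>Exchanging the two columns of the first coordinate turns \<open>Re Z + Im Z\<close> into
    \<open>Re Z - Im Z\<close>; one of the two has absolute value \<open>\<bar>Re Z\<bar> + \<bar>Im Z\<bar>\<close>.\<close>
  have "\<bar>Re Z + Im Z\<bar> = \<bar>Re Z\<bar> + \<bar>Im Z\<bar> \<or> \<bar>Re Z - Im Z\<bar> = \<bar>Re Z\<bar> + \<bar>Im Z\<bar>"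
    by linarith
  then obtain b where "\<bar>Re (char_coef b (\<not> b) * Z)\<bar> = 2 ^ (Suc m div 2)"
  proof
    assume "\<bar>Re Z + Im Z\<bar> = \<bar>Re Z\<bar> + \<bar>Im Z\<bar>"
    then show ?thesis using that[of True] L1 by (simp add: char_coef_def)
  next
    assume "\<bar>Re Z - Im Z\<bar> = \<bar>Re Z\<bar> + \<bar>Im Z\<bar>"
    then show ?thesis using that[of False] L1 by (simp add: char_coef_def)
  qed
  then have r: "rho (design n v) (s b) = 1 / 2 ^ (m div 2)"
    unfolding rho by (simp only: two_power_split)
  moreover have "card (s b) = 1 + m + 2 * freq v 2"
    unfolding m_def using r s(2,3)[of b] by (intro card_word_one[OF v s(1)]) auto
  ultimately show ?thesis using s(1) by blast
qed

section \<open>Resolution of a generated design\<close>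

lemma resolution_eqI:
  assumes s: "s \<subseteq> {..<dim_col D}" "card s = r" "r \<ge> 1" "rho D s = x" "x > 0"
    and le: "\<And>s. s \<subseteq> {..<dim_col D} \<Longrightarrow> s \<noteq> {} \<Longrightarrow> rho D s > 0 \<Longrightarrow>
      r < card s \<or> r = card s \<and> rho D s \<le> x"
  shows "resolution D = real r + 1 - x"
proof -
  let ?R = "\<lambda>k. {rho D s | s. s \<subseteq> {..<dim_col D} \<and> card s = k}"
  have fin: "finite (?R k)" for k
    by (rule finite_subset[of _ "rho D ` Pow {..<dim_col D}"]) auto
  have nonempty: "\<exists>s\<subseteq>{..<dim_col D}. card s = k \<and> max_rho D k = rho D s" if "k \<le> dim_col D" for k
  proof -
    \<comment> \<open>This makes the set of correlations nonempty, so its maximum is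
      attained.\<close>
    have "rho D {..<k} \<in> ?R k" using that by auto
    then have "max_rho D k \<in> ?R k"
      unfolding max_rho_def using fin by (intro Max_in) auto
    then show ?thesis by auto
  qed
  have r: "r \<le> dim_col D" using card_mono[OF _ s(1)] s(2) by simp
  have max: "max_rho D r = x"
    unfolding max_rho_def
  proof (rule Max_eqI[OF fin])
    fix y assume "y \<in> ?R r"
    then obtain s' where s': "s' \<subseteq> {..<dim_col D}" "card s' = r" "y = rho D s'" by auto
    moreover have "s' \<noteq> {}" using s'(2) s(3) by auto
    \<comment> \<open>A vanishing correlation is not covered by \<open>le\<close>; there positivity
      of \<open>x\<close> suffices.\<close>
    ultimately show "y \<le> x" using le[of s'] s(5) by (cases "y > 0") auto
  qed (use s in auto)
  have "min_word_length D = r"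
    unfolding min_word_length_def
  proof (rule Least_equality)
    fix k assume k: "1 \<le> k \<and> k \<le> dim_col D \<and> max_rho D k > 0"
    then obtain s' where s': "s' \<subseteq> {..<dim_col D}" "card s' = k" "max_rho D k = rho D s'"
      using nonempty by blast
    moreover have "s' \<noteq> {}" using s'(2) k by auto
    ultimately show "r \<le> k" using le[of s'] k by auto
  qed (use r s max in auto)
  then show ?thesis by (simp add: resolution_def max)
qed

text \<open>Only the sizes \<open>1 + m + 2 * f\<close> and \<open>2 + 2 * m\<close> occur. The
  first is strictly smaller exactly when \<open>2 * f \<le> m\<close>.\<close>

lemma resolution_design:
  assumes v: "v \<in> carrier_vec n"
  defines "m \<equiv> freq v 1 + freq v 3" and "f \<equiv> freq v 2"
  shows "resolution (design n v) =
    (if 2 * f \<le> m then 2 + real m + 2 * real f - 1 / 2 ^ (m div 2) else 2 + 2 * real m)"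
proof -
  have dim: "dim_col (design n v) = 2 * n + 2" by (simp add: design_def)
  have words: "card s = 2 + 2 * m \<and> rho (design n v) s = 1 \<or>
      card s = 1 + m + 2 * f \<and> rho (design n v) s \<le> 1 / 2 ^ (m div 2)"
    if "s \<subseteq> {..<2 * n + 2}" "s \<noteq> {}" "rho (design n v) s > 0" for s
    using word_none[OF v that(1,3)] word_both[OF v that(1,3)] card_word_one[OF v that(1,3)]
      rho_word_one_le[OF v that(1,3)] that(2)
    unfolding m_def f_def by blast
  show ?thesis
  proof (cases "2 * f \<le> m")
    case True
    obtain s where "s \<subseteq> {..<2 * n + 2}" "card s = 1 + m + 2 * f" "rho (design n v) s = 1 / 2 ^ (m div 2)"
      using ex_word_one[OF v] unfolding m_def f_def by blast
    then have "resolution (design n v) = real (1 + m + 2 * f) + 1 - 1 / 2 ^ (m div 2)"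
    proof (intro resolution_eqI[of s])
      fix s assume "s \<subseteq> {..<dim_col (design n v)}" "s \<noteq> {}" "rho (design n v) s > 0"
      then show "1 + m + 2 * f < card s \<or> 1 + m + 2 * f = card s \<and> rho (design n v) s \<le> 1 / 2 ^ (m div 2)"
        using words[of s] True unfolding dim by linarith
    qed (auto simp: dim)
    then show ?thesis using True by simp
  next
    case False
    obtain s where s: "s \<subseteq> {..<2 * n + 2}" "card s = 2 + 2 * m" "rho (design n v) s = 1"
      using ex_word_both[OF v] unfolding m_def by blast
    \<comment> \<open>For \<open>2 * f = m + 1\<close> both kinds of column sets have the same size,
      and the correlation 1 dominates.\<close>
    have le: "1 / 2 ^ (m div 2) \<le> (1::real)" by simp
    have "resolution (design n v) = real (2 + 2 * m) + 1 - 1"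
      using s
    proof (intro resolution_eqI[of s])
      fix s assume "s \<subseteq> {..<dim_col (design n v)}" "s \<noteq> {}" "rho (design n v) s > 0"
      then show "2 + 2 * m < card s \<or> 2 + 2 * m = card s \<and> rho (design n v) s \<le> 1"
        using words[of s] False le unfolding dim by linarith
    qed (auto simp: dim)
    then show ?thesis using False by simp
  qed
qed

section \<open>Maximizing over all generating vectors\<close>

lemma has_max_resolution_designI:
  assumes "v \<in> carrier_vec n" "resolution (design n v) = x"
    and "\<And>w. w \<in> carrier_vec n \<Longrightarrow> resolution (design n w) \<le> x"
  shows "has_max_resolution (design n v) x (generated_designs n)"
  using assms by (auto simp: has_max_resolution_def generated_designs_def)

lemma resolution_design_le:
  assumes "w \<in> carrier_vec n"
  shows "n = 3 * k - 1 \<Longrightarrow> k \<ge> 1 \<Longrightarrow> resolution (design n w) \<le> 4 * real k"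
    and "n = 3 * k \<Longrightarrow> resolution (design n w) \<le> 4 * real k + 2 - 1 / 2 ^ k"
    and "n = 3 * k + 1 \<Longrightarrow> resolution (design n w) \<le> 4 * real k + 3 - 1 / 2 ^ k"
proof -
  define m f where "m = freq w 1 + freq w 3" and "f = freq w 2"
  define R where "R = resolution (design n w)"
  have mf: "m + f \<le> n" using freq_add_le[OF assms] by (simp add: m_def f_def)
  have pos: "0 < 1 / (2::real) ^ (m div 2)" and le: "1 / (2::real) ^ k \<le> 1" by simp_all
  have R: "2 * f \<le> m \<Longrightarrow> R = real (2 + m + 2 * f) - 1 / 2 ^ (m div 2)"
      "\<not> 2 * f \<le> m \<Longrightarrow> R = real (2 + 2 * m)"
    by (simp_all add: R_def resolution_design[OF assms] flip: m_def f_def)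
  \<comment> \<open>An integer part at most \<open>N - 1\<close> is enough because
    \<open>1 / 2 ^ k \<le> 1\<close>; if the integer part is \<open>N\<close> itself, the exponent
    must be exactly \<open>k\<close>.\<close>
  have R_le: "R \<le> real N - 1 / 2 ^ k"
    if "2 * f \<le> m \<Longrightarrow> 3 + m + 2 * f \<le> N \<or> 2 + m + 2 * f = N \<and> m div 2 = k"
      "\<not> 2 * f \<le> m \<Longrightarrow> 3 + 2 * m \<le> N" for N
  proof (cases "2 * f \<le> m")
    case True
    from that(1)[OF True] show ?thesis
    proof
      assume "3 + m + 2 * f \<le> N"
      then have "real (3 + m + 2 * f) \<le> real N" by (simp only: of_nat_le_iff)
      then show ?thesis using R(1)[OF True] pos le by linarith
    next
      assume "2 + m + 2 * f = N \<and> m div 2 = k"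
      then show ?thesis using R(1)[OF True] by auto
    qed
  next
    case False
    have "real (3 + 2 * m) \<le> real N" using that(2)[OF False] by (simp only: of_nat_le_iff)
    then show ?thesis using R(2)[OF False] le by linarith
  qed
  show "R \<le> 4 * real k" if "n = 3 * k - 1" "k \<ge> 1"
  proof (cases "2 * f \<le> m")
    case True
    \<comment> \<open>From \<open>3 * f \<le> m + f \<le> 3 * k - 1\<close> follows
      \<open>f \<le> k - 1\<close>; add this to the bound on \<open>m + f\<close>.\<close>
    then have "2 + m + 2 * f \<le> 4 * k" using mf that by linarith
    then have "real (2 + m + 2 * f) \<le> real (4 * k)" by (simp only: of_nat_le_iff)
    then show ?thesis using R(1)[OF True] pos by linarith
  next
    case False
    \<comment> \<open>Here \<open>m + 1 \<le> 2 * f\<close>, so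
      \<open>3 * m + 1 \<le> 2 * (m + f) \<le> 6 * k - 2\<close> and
      \<open>m \<le> 2 * k - 1\<close>.\<close>
    then have "2 + 2 * m \<le> 4 * k" using mf that by linarith
    then have "real (2 + 2 * m) \<le> real (4 * k)" by (simp only: of_nat_le_iff)
    then show ?thesis using R(2)[OF False] by simp
  qed
  show "R \<le> 4 * real k + 2 - 1 / 2 ^ k" if "n = 3 * k"
  proof -
    have "R \<le> real (4 * k + 2) - 1 / 2 ^ k"
    proof (rule R_le)
      assume "2 * f \<le> m"
      then have "f < k \<or> f = k \<and> m = 2 * k" using mf that by linarith
      then show "3 + m + 2 * f \<le> 4 * k + 2 \<or> 2 + m + 2 * f = 4 * k + 2 \<and> m div 2 = k"
        using mf that by auto
    next
      assume "\<not> 2 * f \<le> m"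
      then show "3 + 2 * m \<le> 4 * k + 2" using mf that by linarith
    qed
    then show ?thesis by simp
  qed
  show "R \<le> 4 * real k + 3 - 1 / 2 ^ k" if "n = 3 * k + 1"
  proof -
    have "R \<le> real (4 * k + 3) - 1 / 2 ^ k"
    proof (rule R_le)
      assume "2 * f \<le> m"
      \<comment> \<open>Only \<open>m = 2 * k + 1\<close> reaches the integer part
        \<open>4 * k + 3\<close>; \<open>m = 2 * k\<close> falls one short.\<close>
      then have "f < k \<or> f = k \<and> (m = 2 * k \<or> m = 2 * k + 1)" using mf that by linarith
      then show "3 + m + 2 * f \<le> 4 * k + 3 \<or> 2 + m + 2 * f = 4 * k + 3 \<and> m div 2 = k"
        using mf that by auto
    next
      assume "\<not> 2 * f \<le> m"
      then show "3 + 2 * m \<le> 4 * k + 3" using mf that by linarith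
    qed
    then show ?thesis by simp
  qed
qed

theorem theorem5:
  fixes n :: nat
  assumes "n \<ge> 1"
  shows
    "(\<forall>k\<ge>1. n = 3 * k - 1 \<longrightarrow>
       (\<forall>v\<in>carrier_vec n. freq v 1 + freq v 3 = 2 * k - 1 \<and> freq v 2 = k \<longrightarrow>
          has_max_resolution (design n v) (4 * real k) (generated_designs n))) \<and>
     (\<forall>k\<ge>1. n = 3 * k \<longrightarrow>
       (\<forall>v\<in>carrier_vec n. freq v 1 + freq v 3 = 2 * k \<and> freq v 2 = k \<longrightarrow>
          has_max_resolution (design n v) (4 * real k + 2 - 1 / 2 ^ k) (generated_designs n))) \<and>
     (\<forall>k\<ge>1. n = 3 * k + 1 \<longrightarrow>
       (\<forall>v\<in>carrier_vec n. freq v 1 + freq v 3 = 2 * k + 1 \<and> freq v 2 = k \<longrightarrow>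
          has_max_resolution (design n v) (4 * real k + 3 - 1 / 2 ^ k) (generated_designs n)))"
proof (intro conjI allI impI ballI; elim conjE)
  fix k v
  assume k: "k \<ge> 1" "n = 3 * k - 1" and v: "v \<in> carrier_vec n"
    and f: "freq v 1 + freq v 3 = 2 * k - 1" "freq v 2 = k"
  \<comment> \<open>This is the tie \<open>2 * f = m + 1\<close>, so the resolution is
    \<open>2 + 2 * m\<close>.\<close>
  have "resolution (design n v) = 4 * real k"
    unfolding resolution_design[OF v] f using k(1) by (simp add: of_nat_diff)
  then show "has_max_resolution (design n v) (4 * real k) (generated_designs n)"
    using v k by (intro has_max_resolution_designI resolution_design_le)
next
  fix k v
  assume k: "n = 3 * k" and v: "v \<in> carrier_vec n"
    and f: "freq v 1 + freq v 3 = 2 * k" "freq v 2 = k"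
  \<comment> \<open>Here and in the last case \<open>2 * f \<le> m\<close> and
    \<open>m div 2 = k\<close>.\<close>
  have "resolution (design n v) = 4 * real k + 2 - 1 / 2 ^ k"
    unfolding resolution_design[OF v] f by simp
  then show "has_max_resolution (design n v) (4 * real k + 2 - 1 / 2 ^ k) (generated_designs n)"
    using v k by (intro has_max_resolution_designI resolution_design_le)
next
  fix k v
  assume k: "n = 3 * k + 1" and v: "v \<in> carrier_vec n"
    and f: "freq v 1 + freq v 3 = 2 * k + 1" "freq v 2 = k"
  have "resolution (design n v) = 4 * real k + 3 - 1 / 2 ^ k"
    unfolding resolution_design[OF v] f by simp
  then show "has_max_resolution (design n v) (4 * real k + 3 - 1 / 2 ^ k) (generated_designs n)"
    using v k by (intro has_max_resolution_designI resolution_design_le)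
qed

end
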